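(* Let $\omega$ and $d\omega$ be the connection form and the curvature form of the metric $g$ on $\Sigma\cong\mathbb{R}^2$ with respect to the $g$-orthonormal frame $(e_1,e_2)$ (all defined in the context). Then: (1) on $\Sigma\setminus\{0\}$, $\omega = \frac{1}{2r^2}\, g(\partial_\phi,\cdot\,) = \frac12\, d\phi$; (2) $d\omega = \pi\,\delta(x,y)\,dA$ on $\Sigma$ in the sense of distributions, where $\delta(x,y)$ is the 2-dimensional delta function at the origin. That is, $d\omega=0$ on $\Sigma\setminus\{0\}$, and for every smooth compactly supported function $\eta:\Sigma\to\mathbb{R}$ the distributional exterior derivative $\langle d\omega,\eta\rangle := \int_{\Sigma\setminus\{0\}} \omega\wedge d\eta$ equals $\pi\,\eta(0)$.
   Context: $\Sigma=\left\{\begin{pmatrix} x & y \\ y & -x\end{pmatrix}: x,y\in\mathbb{R}\right\}$ is the space of real symmetric trace-free $2\times2$ matrices, a smooth manifold identified with $\mathbb{R}^2$ (with its standard orientation) via global coordinates $(x,y)$. Polar coordinates are $(x,y)=(r\cos\phi,r\sin\phi)$, with coordinate vector fields $\partial_r=\cos\phi\,\partial_x+\sin\phi\,\partial_y$ and $\partial_\phi=-r\sin\phi\,\partial_x+r\cos\phi\,\partial_y$. The 1-form $d\phi=(x\,dy-y\,dx)/r^2$ is globally defined on $\Sigma\setminus\{0\}$. The metric $g$ on $\Sigma\setminus\{0\}$ is the pullback of the Euclidean metric of $\mathbb{R}^3$ under $f(x,y)=(x,y,\sqrt3\sqrt{x^2+y^2})$. In coordinates $(x,y)$ it is $g=\begin{pmatrix}1+3x^2/r^2&3xy/r^2\\3xy/r^2&1+3y^2/r^2\end{pmatrix}$,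 equivalently $g(\partial_r,\partial_r)=4$, $g(\partial_r,\partial_\phi)=0$, $g(\partial_\phi,\partial_\phi)=r^2$. The $g$-orthonormal reference frame on $\Sigma\setminus\{0\}$ is $e_1=\cos\phi\,\frac{\partial_r}{2}-\sin\phi\,\frac{\partial_\phi}{r}$, $e_2=\sin\phi\,\frac{\partial_r}{2}+\cos\phi\,\frac{\partial_\phi}{r}$. Let $\nabla$ be the Levi-Civita connection of $g$ and $R$ its curvature tensor, $R(X,Y,Z,W)=g(\nabla_X\nabla_YZ-\nabla_Y\nabla_XZ-\nabla_{[X,Y]}Z,\,W)$. The connection 1-form is $\omega(X)=g(e_1,\nabla_Xe_2)=-g(\nabla_Xe_1,e_2)$. The curvature 2-form on $\Sigma\setminus\{0\}$ is $d\omega(X,Y)=R(X,Y,e_2,e_1)$, which is the exterior derivative of $\omega$; across the origin, $d\omega$ is understood as the distributional exterior derivative of the locally integrable 1-form $\omega$. The symbol $\delta(x,y)\,dA$ denotes the unit point mass at the origin, so that $\int_U\delta(x,y)\,dA=1$ for every disc $U$ centred at $0$. *)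

theory Defs
  imports "HOL-Analysis.Analysis"
begin

section \<open>Smooth maps on open sets\<close>

text \<open>
  Since every iterated directional derivative is required to exist and to be continuous,
  \<open>Ck_on k S\<close> is the usual class C^k for open \<open>S\<close> in a finite-dimensional space.
\<close>

primrec Ck_on :: "nat \<Rightarrow> 'a::real_normed_vector set \<Rightarrow> ('a \<Rightarrow> 'b::real_normed_vector) \<Rightarrow> bool" where
  "Ck_on 0 S f \<longleftrightarrow> continuous_on S f"
| "Ck_on (Suc k) S f \<longleftrightarrow>
     (\<forall>x\<in>S. f differentiable at x) \<and> (\<forall>v. Ck_on k S (\<lambda>x. frechet_derivative f (at x) v))"

definition smooth_on :: "'a::real_normed_vector set \<Rightarrow> ('a \<Rightarrow> 'b::real_normed_vector) \<Rightarrow> bool" where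
  "smooth_on S f \<longleftrightarrow> (\<forall>k. Ck_on k S f)"

section \<open>Vector fields, forms and connections on an open subset of Euclidean space\<close>

text \<open>
  A vector field on an open set \<open>M\<close> is represented by its coordinate map \<open>'a \<Rightarrow> 'a\<close>; only
  the values on \<open>M\<close> matter. A 1-form is represented by its action on vector fields, the result being
  a function of the base point, and a 2-form likewise.
\<close>

type_synonym 'a vfield = "'a \<Rightarrow> 'a"
type_synonym 'a form1 = "'a vfield \<Rightarrow> 'a \<Rightarrow> real"
type_synonym 'a form2 = "'a vfield \<Rightarrow> 'a vfield \<Rightarrow> 'a \<Rightarrow> real"
type_synonym 'a metric = "'a \<Rightarrow> 'a \<Rightarrow> 'a \<Rightarrow> real"
type_synonym 'a connection = "'a vfield \<Rightarrow> 'a vfield \<Rightarrow> 'a vfield"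

definition dirderiv :: "'a vfield \<Rightarrow> ('a::real_normed_vector \<Rightarrow> 'b::real_normed_vector) \<Rightarrow> 'a \<Rightarrow> 'b" where
  "dirderiv X h p = frechet_derivative h (at p) (X p)"

definition lie_bracket :: "'a::real_normed_vector vfield \<Rightarrow> 'a vfield \<Rightarrow> 'a vfield" where
  "lie_bracket X Y p = dirderiv X Y p - dirderiv Y X p"

definition differential :: "('a::real_normed_vector \<Rightarrow> real) \<Rightarrow> 'a form1" where
  "differential h X p = dirderiv X h p"

definition wedge :: "'a form1 \<Rightarrow> 'a form1 \<Rightarrow> 'a form2" where
  "wedge \<alpha> \<beta> X Y p = \<alpha> X p * \<beta> Y p - \<alpha> Y p * \<beta> X p"

definition ext_deriv :: "'a::real_normed_vector form1 \<Rightarrow> 'a form2" where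
  "ext_deriv \<alpha> X Y p = dirderiv X (\<alpha> Y) p - dirderiv Y (\<alpha> X) p - \<alpha> (lie_bracket X Y) p"

definition affine_connection_on :: "'a::real_normed_vector set \<Rightarrow> 'a connection \<Rightarrow> bool" where
  "affine_connection_on M D \<longleftrightarrow>
     (\<forall>X Y. smooth_on M X \<longrightarrow> smooth_on M Y \<longrightarrow> smooth_on M (D X Y)) \<and>
     (\<forall>X X' Y. smooth_on M X \<longrightarrow> smooth_on M X' \<longrightarrow> smooth_on M Y \<longrightarrow>
        (\<forall>p\<in>M. D (\<lambda>q. X q + X' q) Y p = D X Y p + D X' Y p)) \<and>
     (\<forall>h X Y. smooth_on M h \<longrightarrow> smooth_on M X \<longrightarrow> smooth_on M Y \<longrightarrow>
        (\<forall>p\<in>M. D (\<lambda>q. h q *\<^sub>R X q) Y p = h p *\<^sub>R D X Y p)) \<and>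
     (\<forall>X Y Y'. smooth_on M X \<longrightarrow> smooth_on M Y \<longrightarrow> smooth_on M Y' \<longrightarrow>
        (\<forall>p\<in>M. D X (\<lambda>q. Y q + Y' q) p = D X Y p + D X Y' p)) \<and>
     (\<forall>h X Y. smooth_on M h \<longrightarrow> smooth_on M X \<longrightarrow> smooth_on M Y \<longrightarrow>
        (\<forall>p\<in>M. D X (\<lambda>q. h q *\<^sub>R Y q) p = dirderiv X h p *\<^sub>R Y p + h p *\<^sub>R D X Y p))"

definition levi_civita_on ::
  "'a::real_normed_vector set \<Rightarrow> 'a metric \<Rightarrow> 'a connection \<Rightarrow> bool" where
  "levi_civita_on M g D \<longleftrightarrow>
     affine_connection_on M D \<and>
     (\<forall>X Y. smooth_on M X \<longrightarrow> smooth_on M Y \<longrightarrow>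
        (\<forall>p\<in>M. D X Y p - D Y X p = lie_bracket X Y p)) \<and>
     (\<forall>X Y Z. smooth_on M X \<longrightarrow> smooth_on M Y \<longrightarrow> smooth_on M Z \<longrightarrow>
        (\<forall>p\<in>M. dirderiv X (\<lambda>q. g q (Y q) (Z q)) p = g p (D X Y p) (Z p) + g p (Y p) (D X Z p)))"

definition curvature_tensor ::
  "'a::real_normed_vector metric \<Rightarrow> 'a connection \<Rightarrow>
     'a vfield \<Rightarrow> 'a vfield \<Rightarrow> 'a vfield \<Rightarrow> 'a vfield \<Rightarrow> 'a \<Rightarrow> real" where
  "curvature_tensor g D X Y Z W p =
     g p (D X (D Y Z) p - D Y (D X Z) p - D (lie_bracket X Y) Z p) (W p)"

section \<open>The cone metric on the punctured plane\<close>

text \<open>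
  The space of real symmetric trace-free 2 by 2 matrices is identified with the plane by sending the
  matrix with first row \<open>x, y\<close> and second row \<open>y, -x\<close> to \<open>(x, y)\<close>. The norm of
  \<open>real \<times> real\<close> is the Euclidean one, i.e. the polar radius.
\<close>

type_synonym plane = "real \<times> real"

abbreviation punctured_plane :: "plane set" where
  "punctured_plane \<equiv> - {0}"

definition pullback_metric ::
  "('a::real_normed_vector \<Rightarrow> 'b::real_inner) \<Rightarrow> 'a metric" where
  "pullback_metric f p u v = frechet_derivative f (at p) u \<bullet> frechet_derivative f (at p) v"

definition cone_map :: "plane \<Rightarrow> real \<times> real \<times> real" where
  "cone_map = (\<lambda>(x, y). (x, y, sqrt 3 * sqrt (x\<^sup>2 + y\<^sup>2)))"

definition cone_metric :: "plane metric" where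
  "cone_metric = pullback_metric cone_map"

definition cos_phi :: "plane \<Rightarrow> real" where
  "cos_phi p = fst p / norm p"

definition sin_phi :: "plane \<Rightarrow> real" where
  "sin_phi p = snd p / norm p"

definition d_x :: "plane vfield" where
  "d_x p = (1, 0)"

definition d_y :: "plane vfield" where
  "d_y p = (0, 1)"

definition d_r :: "plane vfield" where
  "d_r p = cos_phi p *\<^sub>R d_x p + sin_phi p *\<^sub>R d_y p"

definition d_phi :: "plane vfield" where
  "d_phi p = (- norm p * sin_phi p) *\<^sub>R d_x p + (norm p * cos_phi p) *\<^sub>R d_y p"

text \<open>The closed 1-form \<open>d\<phi> = (x dy - y dx) / r\<^sup>2\<close>; there is no global function \<open>\<phi>\<close>.\<close>

definition angular_form :: "plane form1" where
  "angular_form X p = (fst p * snd (X p) - snd p * fst (X p)) / (norm p)\<^sup>2"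

definition frame1 :: "plane vfield" where
  "frame1 p = (cos_phi p / 2) *\<^sub>R d_r p - (sin_phi p / norm p) *\<^sub>R d_phi p"

definition frame2 :: "plane vfield" where
  "frame2 p = (sin_phi p / 2) *\<^sub>R d_r p + (cos_phi p / norm p) *\<^sub>R d_phi p"

definition connection_form :: "plane connection \<Rightarrow> plane form1" where
  "connection_form D X p = cone_metric p (frame1 p) (D X frame2 p)"

definition curvature_form :: "plane connection \<Rightarrow> plane form2" where
  "curvature_form D X Y = curvature_tensor cone_metric D X Y frame2 frame1"

section \<open>Distributional exterior derivative\<close>

text \<open>
  The integral of a 2-form over an oriented planar set is the Lebesgue integral of its value
  on \<open>(\<partial>\<^sub>x, \<partial>\<^sub>y)\<close>. As the Bochner integral of a non-integrable function is \<open>0\<close>, integrability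
  has to be tracked separately.
\<close>

definition form2_integrable_on :: "plane set \<Rightarrow> plane form2 \<Rightarrow> bool" where
  "form2_integrable_on U \<beta> \<longleftrightarrow> set_integrable lborel U (\<lambda>p. \<beta> d_x d_y p)"

definition form2_integral :: "plane set \<Rightarrow> plane form2 \<Rightarrow> real" where
  "form2_integral U \<beta> = (LINT p:U|lborel. \<beta> d_x d_y p)"

definition distr_ext_deriv :: "plane form1 \<Rightarrow> (plane \<Rightarrow> real) \<Rightarrow> real" where
  "distr_ext_deriv \<alpha> \<eta> = form2_integral punctured_plane (wedge \<alpha> (differential \<eta>))"

definition test_function :: "(plane \<Rightarrow> real) \<Rightarrow> bool" where
  "test_function \<eta> \<longleftrightarrow> smooth_on UNIV \<eta> \<and> compact (closure {p. \<eta> p \<noteq> 0})"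

section \<open>Polar components of the cone metric\<close>

lemma norm_plane: "norm (p::plane) = sqrt ((fst p)\<^sup>2 + (snd p)\<^sup>2)"
  by (cases p) (simp add: norm_Pair)

lemma polar_angle:
  assumes "\<rho> > 0"
  shows "norm (\<rho> * cos t, \<rho> * sin t) = \<rho>"
    and "cos_phi (\<rho> * cos t, \<rho> * sin t) = cos t"
    and "sin_phi (\<rho> * cos t, \<rho> * sin t) = sin t"
proof -
  have "(\<rho> * cos t)\<^sup>2 + (\<rho> * sin t)\<^sup>2 = \<rho>\<^sup>2 * ((sin t)\<^sup>2 + (cos t)\<^sup>2)"
    unfolding power_mult_distrib by algebra
  then show *: "norm (\<rho> * cos t, \<rho> * sin t) = \<rho>"
    using assms by (simp add: norm_Pair)
  show "cos_phi (\<rho> * cos t, \<rho> * sin t) = cos t" "sin_phi (\<rho> * cos t, \<rho> * sin t) = sin t"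
    using assms by (simp_all add: cos_phi_def sin_phi_def *)
qed

lemma cone_map_derivative:
  assumes "p \<noteq> 0"
  shows "(cone_map has_derivative (\<lambda>u. (fst u, snd u, sqrt 3 * ((p \<bullet> u) / norm p)))) (at p)"
proof -
  have eq: "cone_map = (\<lambda>q. (fst q, snd q, sqrt 3 * norm q))"
    by (auto simp: cone_map_def norm_Pair fun_eq_iff)
  have "(norm has_derivative (\<lambda>u. (p \<bullet> u) / norm p)) (at p)"
    using has_derivative_norm[OF assms] by (simp add: sgn_div_norm divide_inverse mult.commute inner_commute)
  then show ?thesis
    unfolding eq by (auto intro!: derivative_eq_intros)
qed

lemma cone_metric_eq:
  assumes "p \<noteq> 0"
  shows "cone_metric p u v = u \<bullet> v + 3 * (p \<bullet> u) * (p \<bullet> v) / (p \<bullet> p)"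
proof -
  have "frechet_derivative cone_map (at p) = (\<lambda>u. (fst u, snd u, sqrt 3 * ((p \<bullet> u) / norm p)))"
    by (rule frechet_derivative_at[OF cone_map_derivative[OF assms], symmetric])
  then have "cone_metric p u v =
      u \<bullet> v + (sqrt 3 * ((p \<bullet> u) / norm p)) * (sqrt 3 * ((p \<bullet> v) / norm p))"
    by (simp only: cone_metric_def pullback_metric_def inner_prod_def fst_conv snd_conv
        inner_real_def add.assoc)
  also have "\<dots> = u \<bullet> v + (sqrt 3 * sqrt 3) * (p \<bullet> u) * (p \<bullet> v) / (norm p * norm p)"
    by (simp only: times_divide_eq_left times_divide_eq_right divide_divide_eq_left mult_ac)
  also have "norm p * norm p = p \<bullet> p"
    by (metis dot_square_norm power2_eq_square)
  finally show ?thesis by simp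
qed

lemma cone_metric_polar:
  assumes "p \<noteq> 0"
  shows "cone_metric p (d_r p) (d_r p) = 4"
    and "cone_metric p (d_r p) (d_phi p) = 0"
    and "cone_metric p (d_phi p) (d_phi p) = (norm p)\<^sup>2"
proof -
  obtain x y where p: "p = (x, y)" by (cases p)
  define n where "n = norm p"
  have n: "x * x + y * y = n * n" "n \<noteq> 0"
    using assms by (auto simp: n_def p norm_Pair power2_eq_square zero_prod_def)
  have r: "d_r p = (x / n, y / n)" and f: "d_phi p = (- y, x)"
    using n(2) by (simp_all add: d_r_def d_phi_def d_x_def d_y_def cos_phi_def sin_phi_def n_def[symmetric])
      (simp_all add: p)
  have q: "p \<bullet> (v, w) = x * v + y * w" for v w
    by (simp add: p)
  have sq: "x * (x / n) + y * (y / n) = (x * x + y * y) / n"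
    "(x / n) * (x / n) + (y / n) * (y / n) = (x * x + y * y) / (n * n)"
    by (simp_all add: add_divide_distrib)
  have pr: "p \<bullet> d_r p = norm p" "d_r p \<bullet> d_r p = 1"
    unfolding r q n_def[symmetric] inner_Pair inner_real_def sq n(1) using n(2) by simp_all
  have pf: "p \<bullet> d_phi p = 0" "d_phi p \<bullet> d_phi p = (norm p)\<^sup>2" "d_r p \<bullet> d_phi p = 0"
    unfolding r f q n_def[symmetric] inner_Pair inner_real_def using n by (simp_all add: power2_eq_square)
  have N: "norm p \<noteq> 0" using assms by simp
  have "p \<bullet> p = norm p * norm p"
    by (simp add: dot_square_norm power2_eq_square)
  then show "cone_metric p (d_r p) (d_r p) = 4" "cone_metric p (d_r p) (d_phi p) = 0"
    "cone_metric p (d_phi p) (d_phi p) = (norm p)\<^sup>2"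
    using N unfolding cone_metric_eq[OF assms] pr pf by simp_all
qed

section \<open>Existence of the Levi-Civita connection\<close>

lemma frechet_derivative_eqI: "(f has_derivative f') (at x) \<Longrightarrow> frechet_derivative f (at x) = f'"
  by (rule frechet_derivative_at[symmetric])

lemma Ck_on_cong:
  assumes "open S" "\<And>x. x \<in> S \<Longrightarrow> f x = g x" "Ck_on k S f"
  shows "Ck_on k S g"
  using assms(2,3)
proof (induction k arbitrary: f g)
  case 0
  then show ?case by (simp cong: continuous_on_cong)
next
  case (Suc k)
  have d: "(g has_derivative frechet_derivative f (at x)) (at x)" if "x \<in> S" for x
  proof (rule has_derivative_transform_within_open[OF _ \<open>open S\<close> that])
    show "(f has_derivative frechet_derivative f (at x)) (at x)"
      using Suc.prems(2) that by (simp add: frechet_derivative_works)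
  qed (use Suc.prems(1) in auto)
  have "Ck_on k S (\<lambda>x. frechet_derivative g (at x) v)" for v
    by (rule Suc.IH[of "\<lambda>x. frechet_derivative f (at x) v"])
      (use Suc.prems(2) frechet_derivative_eqI[OF d] in auto)
  then show ?case
    using d by (auto simp: differentiable_def)
qed

lemma Ck_on_SucI:
  assumes "open S" "\<And>x. x \<in> S \<Longrightarrow> (f has_derivative f' x) (at x)" "\<And>v. Ck_on k S (\<lambda>x. f' x v)"
  shows "Ck_on (Suc k) S f"
proof -
  have "Ck_on k S (\<lambda>x. frechet_derivative f (at x) v)" for v
    by (rule Ck_on_cong[OF assms(1) _ assms(3)[of v]]) (simp add: frechet_derivative_eqI[OF assms(2)])
  then show ?thesis
    using assms(2) by (auto simp: differentiable_def)
qed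

lemma Ck_on_SucD: "Ck_on (Suc k) S f \<Longrightarrow> Ck_on k S f"
proof (induction k arbitrary: f)
  case 0
  then show ?case
    by (metis Ck_on.simps differentiable_at_imp_differentiable_on differentiable_imp_continuous_on)
next
  case (Suc k)
  then show ?case by simp
qed

lemma Ck_on_derivative:
  "Ck_on (Suc k) S f \<Longrightarrow> x \<in> S \<Longrightarrow> (f has_derivative frechet_derivative f (at x)) (at x)"
  by (simp add: frechet_derivative_works)

lemma Ck_on_const: "open S \<Longrightarrow> Ck_on k S (\<lambda>x. c)"
proof (induction k arbitrary: c)
  case (Suc k)
  show ?case by (rule Ck_on_SucI[where f' = "\<lambda>_ _. 0"]) (auto intro: Suc)
qed simp

lemma Ck_on_add:
  assumes "open S"
  shows "Ck_on k S f \<Longrightarrow> Ck_on k S g \<Longrightarrow> Ck_on k S (\<lambda>x. f x + g x)"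
proof (induction k arbitrary: f g)
  case 0
  then show ?case by (simp add: continuous_on_add)
next
  case (Suc k)
  show ?case
    by (rule Ck_on_SucI[OF assms has_derivative_add[OF Ck_on_derivative Ck_on_derivative]])
      (use Suc in auto)
qed

lemma Ck_on_linear:
  assumes "open S" "bounded_linear L"
  shows "Ck_on k S f \<Longrightarrow> Ck_on k S (\<lambda>x. L (f x))"
proof (induction k arbitrary: f)
  case 0
  then show ?case by (simp add: bounded_linear.continuous_on[OF assms(2)])
next
  case (Suc k)
  show ?case
    by (rule Ck_on_SucI[OF assms(1) bounded_linear.has_derivative[OF assms(2) Ck_on_derivative]])
      (use Suc in auto)
qed

lemma Ck_on_bilinear:
  assumes "open S" "bounded_bilinear B"
  shows "Ck_on k S f \<Longrightarrow> Ck_on k S g \<Longrightarrow> Ck_on k S (\<lambda>x. B (f x) (g x))"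
proof (induction k arbitrary: f g)
  case 0
  then show ?case by (simp add: bounded_bilinear.continuous_on[OF assms(2)])
next
  case (Suc k)
  have "Ck_on k S f" "Ck_on k S g"
    using Suc.prems by (auto intro: Ck_on_SucD)
  then show ?case
    by (intro Ck_on_SucI[OF assms(1)
          bounded_bilinear.FDERIV[OF assms(2) Ck_on_derivative Ck_on_derivative]] Ck_on_add[OF assms(1)])
      (use Suc in auto)
qed

lemma Ck_on_identity: "open S \<Longrightarrow> Ck_on k S (\<lambda>x. x)"
proof (cases k)
  case (Suc n)
  assume "open S"
  then show ?thesis
    unfolding Suc by (intro Ck_on_SucI[where f' = "\<lambda>_ v. v"] has_derivative_ident Ck_on_const)
qed simp

lemma Ck_on_inverse:
  fixes f :: "'a::real_normed_vector \<Rightarrow> real"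
  assumes "open S" "\<And>x. x \<in> S \<Longrightarrow> f x \<noteq> 0"
  shows "Ck_on k S f \<Longrightarrow> Ck_on k S (\<lambda>x. inverse (f x))"
proof (induction k)
  case 0
  then show ?case by (simp add: continuous_on_inverse assms)
next
  case (Suc k)
  let ?f' = "\<lambda>x v. - (inverse (f x) * frechet_derivative f (at x) v * inverse (f x))"
  have "Ck_on k S (\<lambda>x. inverse (f x))"
    using Suc.IH Ck_on_SucD[OF Suc.prems] by blast
  then have "Ck_on k S (\<lambda>x. ?f' x v)" for v
    using Suc.prems
    by (intro Ck_on_linear[OF assms(1) bounded_linear_minus[OF bounded_linear_ident]]
        Ck_on_bilinear[OF assms(1) bounded_bilinear_mult]) auto
  then show ?case
    by (intro Ck_on_SucI[OF assms(1), of _ ?f'] Deriv.has_derivative_inverse)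
      (use assms(2) Suc.prems in \<open>auto intro: Ck_on_derivative\<close>)
qed

lemma smooth_on_derivative:
  "smooth_on S f \<Longrightarrow> x \<in> S \<Longrightarrow> (f has_derivative frechet_derivative f (at x)) (at x)"
  unfolding smooth_on_def using Ck_on_derivative by blast

lemma smooth_on_frechet: "smooth_on S f \<Longrightarrow> smooth_on S (\<lambda>x. frechet_derivative f (at x) v)"
  unfolding smooth_on_def by (metis Ck_on.simps(2))

lemma smooth_on_dirderiv:
  fixes X :: "plane vfield"
  assumes "open S" "smooth_on S X" "smooth_on S Y"
  shows "smooth_on S (dirderiv X Y)"
proof -
  have eq: "fst (X p) *\<^sub>R frechet_derivative Y (at p) (1, 0)
      + snd (X p) *\<^sub>R frechet_derivative Y (at p) (0, 1) = dirderiv X Y p" if "p \<in> S" for p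
  proof -
    interpret linear "frechet_derivative Y (at p)"
      using smooth_on_derivative[OF assms(3) that] by (rule has_derivative_linear)
    have "X p = fst (X p) *\<^sub>R (1, 0) + snd (X p) *\<^sub>R (0, 1)"
      by (cases "X p") simp
    then show ?thesis
      unfolding dirderiv_def by (metis add scale)
  qed
  have "smooth_on S (\<lambda>p. fst (X p) *\<^sub>R frechet_derivative Y (at p) (1, 0)
      + snd (X p) *\<^sub>R frechet_derivative Y (at p) (0, 1))"
    using assms smooth_on_frechet[OF assms(3)] unfolding smooth_on_def
    by (intro allI Ck_on_add Ck_on_bilinear[OF _ bounded_bilinear_scaleR] Ck_on_linear[OF _ bounded_linear_fst]
        Ck_on_linear[OF _ bounded_linear_snd]) auto
  then show ?thesis
    unfolding smooth_on_def by (intro allI Ck_on_cong[OF assms(1) eq]) auto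
qed

definition rot :: "plane \<Rightarrow> plane" where
  "rot p = (- snd p, fst p)"

text \<open>The second summand is the Christoffel term of the cone metric in Cartesian coordinates.\<close>

definition cone_connection :: "plane connection" where
  "cone_connection X Y p =
     dirderiv X Y p + (3/4 * ((rot p \<bullet> X p) * (rot p \<bullet> Y p)) * (inverse (p \<bullet> p) * inverse (p \<bullet> p))) *\<^sub>R p"

lemma bounded_linear_rot: "bounded_linear rot"
  unfolding rot_def
  by (intro bounded_linear_Pair bounded_linear_minus bounded_linear_fst bounded_linear_snd)

lemma smooth_on_cone_connection:
  assumes "smooth_on punctured_plane X" "smooth_on punctured_plane Y"
  shows "smooth_on punctured_plane (cone_connection X Y)"
proof -
  have S: "open punctured_plane" by auto
  show ?thesis
    using smooth_on_dirderiv[OF S assms] assms unfolding smooth_on_def cone_connection_def[abs_def]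
    by (intro allI Ck_on_add[OF S] Ck_on_bilinear[OF S bounded_bilinear_scaleR]
        Ck_on_bilinear[OF S bounded_bilinear_mult] Ck_on_bilinear[OF S bounded_bilinear_inner]
        Ck_on_linear[OF S bounded_linear_rot] Ck_on_inverse[OF S] Ck_on_const[OF S] Ck_on_identity[OF S])
      auto
qed

lemma cone_connection_metric:
  assumes "p \<noteq> 0"
    and Y: "(Y has_derivative Y') (at p)" and Z: "(Z has_derivative Z') (at p)"
  shows "dirderiv X (\<lambda>q. cone_metric q (Y q) (Z q)) p =
    cone_metric p (cone_connection X Y p) (Z p) + cone_metric p (Y p) (cone_connection X Z p)"
proof -
  let ?G = "\<lambda>q. Y q \<bullet> Z q + 3 * (q \<bullet> Y q) * (q \<bullet> Z q) / (q \<bullet> q)"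
  let ?G' = "\<lambda>u. Y p \<bullet> Z' u + Y' u \<bullet> Z p
    + 3 * (((p \<bullet> Y' u + u \<bullet> Y p) * (p \<bullet> Z p) + (p \<bullet> Y p) * (p \<bullet> Z' u + u \<bullet> Z p)) * (p \<bullet> p)
        - (p \<bullet> Y p) * (p \<bullet> Z p) * (2 * (p \<bullet> u))) / ((p \<bullet> p) * (p \<bullet> p))"
  have pp: "p \<bullet> p \<noteq> 0" using assms(1) by simp
  have "(?G has_derivative ?G') (at p)"
    by (rule derivative_eq_intros Y Z refl pp)+
      (use pp in \<open>simp add: fun_eq_iff inner_commute field_simps\<close>)
  then have "((\<lambda>q. cone_metric q (Y q) (Z q)) has_derivative ?G') (at p)"
    by (rule has_derivative_transform_within_open[where s = "- {0}"])
      (use assms(1) in \<open>auto simp: cone_metric_eq\<close>)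
  then have L: "dirderiv X (\<lambda>q. cone_metric q (Y q) (Z q)) p = ?G' (X p)"
    unfolding dirderiv_def by (simp add: frechet_derivative_eqI)
  define u where "u = X p"
  define y z y' z' where "y = Y p" "z = Z p" "y' = Y' u" "z' = Z' u"
  note defs = \<open>y = _\<close> \<open>z = _\<close> \<open>y' = _\<close> \<open>z' = _\<close> u_def
  define n where "n = p \<bullet> p"
  have n: "n \<noteq> 0" using pp n_def by simp
  have key: "n * (u \<bullet> w) = (p \<bullet> u) * (p \<bullet> w) + (rot p \<bullet> u) * (rot p \<bullet> w)" for w
    unfolding n_def
    by (cases p; cases u; cases w) (simp add: rot_def inner_Pair algebra_simps)
  have C: "cone_connection X Y p = y' + (3/4 * ((rot p \<bullet> u) * (rot p \<bullet> y)) / (n * n)) *\<^sub>R p"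
    "cone_connection X Z p = z' + (3/4 * ((rot p \<bullet> u) * (rot p \<bullet> z)) / (n * n)) *\<^sub>R p"
    unfolding cone_connection_def dirderiv_def frechet_derivative_eqI[OF Y] frechet_derivative_eqI[OF Z]
      defs n_def by (simp_all only: divide_inverse inverse_mult_distrib)
  have e1: "cone_metric p (v + c *\<^sub>R p) w = v \<bullet> w + 3 * (p \<bullet> v) * (p \<bullet> w) / n + 4 * c * (p \<bullet> w)"
    for v w c
  proof -
    have "cone_metric p (v + c *\<^sub>R p) w = v \<bullet> w + c * (p \<bullet> w) + 3 * (p \<bullet> v + c * n) * (p \<bullet> w) / n"
      by (simp only: cone_metric_eq[OF assms(1)] n_def inner_add_left inner_add_right
          inner_scaleR_left inner_scaleR_right)
    then show ?thesis
      using n by (simp add: field_simps)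
  qed
  have e2: "cone_metric p w (v + c *\<^sub>R p) = w \<bullet> v + 3 * (p \<bullet> w) * (p \<bullet> v) / n + 4 * c * (p \<bullet> w)" for v w c
  proof -
    have "cone_metric p w a = cone_metric p a w" for a
      by (simp add: cone_metric_eq[OF assms(1)] inner_commute[of w a] mult.commute mult.left_commute)
    then show ?thesis
      by (simp add: e1 inner_commute[of v w])
  qed
  have k: "(rot p \<bullet> u) * (rot p \<bullet> w) = n * (u \<bullet> w) - (p \<bullet> u) * (p \<bullet> w)" for w
    using key[of w] by simp
  show ?thesis
    unfolding L C e1 e2 k unfolding defs[symmetric] n_def[symmetric]
    using n by (simp add: field_simps)
qed

lemma levi_civita_on_cone_connection: "levi_civita_on punctured_plane cone_metric cone_connection"
proof -
  note d = smooth_on_derivative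
  have lin: "linear (frechet_derivative Y (at p))"
    if "smooth_on punctured_plane Y" "p \<in> punctured_plane" for Y :: "plane vfield" and p
    using d[OF that] by (rule has_derivative_linear)
  have "cone_connection X (\<lambda>q. Y q + Y' q) p = cone_connection X Y p + cone_connection X Y' p"
    if "smooth_on punctured_plane Y" "smooth_on punctured_plane Y'" "p \<in> punctured_plane" for X Y Y' p
    using frechet_derivative_eqI[OF has_derivative_add[OF d d, OF that(1,3,2,3)]]
    by (simp add: cone_connection_def dirderiv_def inner_add algebra_simps)
  moreover have "cone_connection X (\<lambda>q. h q *\<^sub>R Y q) p = dirderiv X h p *\<^sub>R Y p + h p *\<^sub>R cone_connection X Y p"
    if "smooth_on punctured_plane h" "smooth_on punctured_plane Y" "p \<in> punctured_plane" for h X Y p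
    using frechet_derivative_eqI[OF has_derivative_scaleR[OF d d, OF that(1,3,2,3)]]
    by (simp add: cone_connection_def dirderiv_def algebra_simps)
  moreover have "cone_connection (\<lambda>q. X q + X' q) Y p = cone_connection X Y p + cone_connection X' Y p"
    if "smooth_on punctured_plane Y" "p \<in> punctured_plane" for X X' Y p
    by (simp add: cone_connection_def dirderiv_def linear_add[OF lin[OF that]] inner_add algebra_simps)
  moreover have "cone_connection (\<lambda>q. h q *\<^sub>R X q) Y p = h p *\<^sub>R cone_connection X Y p"
    if "smooth_on punctured_plane Y" "p \<in> punctured_plane" for h X Y p
    by (simp add: cone_connection_def dirderiv_def linear_scale[OF lin[OF that]] algebra_simps)
  ultimately have "affine_connection_on punctured_plane cone_connection"
    unfolding affine_connection_on_def by (intro conjI allI impI ballI smooth_on_cone_connection) blast+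
  moreover have "cone_connection X Y p - cone_connection Y X p = lie_bracket X Y p" for X Y p
    by (simp add: cone_connection_def lie_bracket_def algebra_simps)
  ultimately show ?thesis
    unfolding levi_civita_on_def
    by (auto intro!: cone_connection_metric intro: d)
qed

end

theory Submission
  imports Defs
begin

text \<open>
  In Cartesian coordinates the reference frame is \<open>e\<^sub>i = \<partial>\<^sub>i - x\<^sub>i / (2 r\<^sup>2) (x, y)\<close>, so
  that the connection form can be read off from the Christoffel term of the cone metric. As
  \<open>\<nabla> e\<^sub>2 = \<omega> e\<^sub>1\<close> with \<open>e\<^sub>1\<close> of unit length, the curvature form is \<open>d\<omega>\<close>, and \<open>d\<phi>\<close> is closed.

  For the distributional statement one has to integrate \<open>- q \<bullet> \<nabla>\<eta>(q) / (2 |q|\<^sup>2)\<close> over the plane.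
  Writing \<open>1 / |q|\<^sup>2\<close> as the integral of \<open>2 / t\<^sup>3\<close> over \<open>t \<ge> |q|\<close>, exchanging the integrals and
  substituting \<open>q = t p\<close> turns this into the integral over \<open>|p| \<le> 1\<close> of
  \<open>- \<integral> p \<bullet> \<nabla>\<eta>(t p) dt = \<eta>(0)\<close>, i.e. \<open>\<eta>(0)\<close> times the area \<open>\<pi>\<close> of the unit disc.
\<close>

section \<open>The connection form and its curvature\<close>

text \<open>Since \<partial>_x = cos \<phi> \<partial>_r - sin \<phi> \<partial>_\<phi> / r, halving
  the radial part of \<partial>_x subtracts (cos \<phi> / 2) \<partial>_r, which is x / (2 r^2)
  times the position vector; likewise for \<partial>_y. The result is rational in the coordinates,
  so it can be differentiated without touching the norm.\<close>

lemma frame_eq: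
  assumes "p \<noteq> 0"
  shows "frame1 p = (1, 0) - (fst p / 2 * inverse (p \<bullet> p)) *\<^sub>R p"
    and "frame2 p = (0, 1) - (snd p / 2 * inverse (p \<bullet> p)) *\<^sub>R p"
proof -
  obtain x y where p: "p = (x, y)" by (cases p)
  define n where "n = norm p"
  have n: "x * x + y * y = n * n" "n \<noteq> 0"
    using assms by (auto simp: n_def p norm_Pair power2_eq_square zero_prod_def)
  have pp: "p \<bullet> p = n * n" by (simp add: p n)
  have xy: "x * x = n * n - y * y" using n by simp
  show "frame1 p = (1, 0) - (fst p / 2 * inverse (p \<bullet> p)) *\<^sub>R p"
    and "frame2 p = (0, 1) - (snd p / 2 * inverse (p \<bullet> p)) *\<^sub>R p"
    unfolding frame1_def frame2_def d_r_def d_phi_def d_x_def d_y_def cos_phi_def sin_phi_def pp n_def[symmetric]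
    using n(2) by (auto simp: p field_simps xy power2_eq_square)
qed

lemma smooth_on_frame:
  "smooth_on punctured_plane frame1" "smooth_on punctured_plane frame2"
proof -
  have S: "open punctured_plane" by auto
  have sm: "Ck_on k punctured_plane (\<lambda>p. e - (\<phi> p / 2 * inverse (p \<bullet> p)) *\<^sub>R p)"
    if "bounded_linear \<phi>" for k \<phi> and e :: plane
  proof -
    have "bounded_linear (\<lambda>p. - (\<phi> p / 2))"
      using that by (intro bounded_linear_minus bounded_linear_divide[THEN bounded_linear_compose])
    \<comment> \<open>The difference is written as a sum with a negated linear coefficient, so that
      closure under sums and bilinear products applies. An arbitrary linear \<open>\<phi>\<close>
      treats both frame fields at once.\<close>
    then have "Ck_on k punctured_plane (\<lambda>p. e + ((- (\<phi> p / 2)) * inverse (p \<bullet> p)) *\<^sub>R p)"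
      by (intro Ck_on_add[OF S] Ck_on_bilinear[OF S bounded_bilinear_scaleR] Ck_on_const[OF S]
        Ck_on_bilinear[OF S bounded_bilinear_mult] Ck_on_bilinear[OF S bounded_bilinear_inner]
        Ck_on_linear[OF S, of "\<lambda>p. - (\<phi> p / 2)"] Ck_on_inverse[OF S] Ck_on_identity[OF S]) auto
    then show ?thesis by simp
  qed
  show "smooth_on punctured_plane frame1" "smooth_on punctured_plane frame2"
    unfolding smooth_on_def
    by (intro allI Ck_on_cong[OF S _ sm[OF bounded_linear_fst, of _ "(1, 0)"]]; simp add: frame_eq)
      (intro allI Ck_on_cong[OF S _ sm[OF bounded_linear_snd, of _ "(0, 1)"]]; simp add: frame_eq)
qed

section \<open>Pointwise linear algebra of the cone metric and the frame\<close>

lemma cone_metric_linear: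
  assumes "p \<noteq> 0"
  shows "cone_metric p (u + v) w = cone_metric p u w + cone_metric p v w"
    and "cone_metric p (u - v) w = cone_metric p u w - cone_metric p v w"
    and "cone_metric p (c *\<^sub>R u) w = c * cone_metric p u w"
  using assms by (simp_all add: cone_metric_eq inner_add inner_diff field_simps)

lemma cone_metric_commute: "p \<noteq> 0 \<Longrightarrow> cone_metric p u v = cone_metric p v u"
  by (simp add: cone_metric_eq inner_commute[of u v] mult_ac)

text \<open>The metric is the Euclidean one plus a nonnegative rank-one term, so a null vector is
  already Euclidean null.\<close>

lemma cone_metric_definite:
  assumes "p \<noteq> 0" "cone_metric p u u = 0"
  shows "u = 0"
proof -
  have "u \<bullet> u + 3 * ((p \<bullet> u)\<^sup>2 / (p \<bullet> p)) = 0"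
    using assms by (simp add: cone_metric_eq power2_eq_square mult.assoc)
  moreover have "0 \<le> (p \<bullet> u)\<^sup>2 / (p \<bullet> p)" by simp
  ultimately have "u \<bullet> u \<le> 0" by linarith
  then show ?thesis
    using inner_gt_zero_iff[of u] by linarith
qed

text \<open>With p \<bullet> e_i = x_i / 2, the cone term contributes (3/4) x_i x_j / n, exactly the
  defect of the Euclidean Gram matrix of the frame.\<close>

lemma frame_orthonormal:
  assumes "p \<noteq> 0"
  shows "cone_metric p (frame1 p) (frame1 p) = 1"
    and "cone_metric p (frame1 p) (frame2 p) = 0"
    and "cone_metric p (frame2 p) (frame2 p) = 1"
proof -
  obtain x y where p: "p = (x, y)" by (cases p)
  define n where "n = p \<bullet> p"
  have n: "n \<noteq> 0" using assms by (simp add: n_def)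
  have pf: "p \<bullet> frame1 p = x / 2" "p \<bullet> frame2 p = y / 2"
    unfolding frame_eq[OF assms] inner_diff_right inner_scaleR_right n_def[symmetric]
    using n by (simp_all add: p)
  have "frame1 p \<bullet> frame1 p = 1 - 3/4 * (x * x) / n" "frame1 p \<bullet> frame2 p = - (3/4 * (x * y) / n)"
    "frame2 p \<bullet> frame2 p = 1 - 3/4 * (y * y) / n"
    unfolding frame_eq[OF assms] inner_diff_right inner_diff_left inner_scaleR_right inner_scaleR_left
      n_def[symmetric]
    using n by (simp_all add: p field_simps)
  then show "cone_metric p (frame1 p) (frame1 p) = 1"
    and "cone_metric p (frame1 p) (frame2 p) = 0"
    and "cone_metric p (frame2 p) (frame2 p) = 1"
    unfolding cone_metric_eq[OF assms] pf n_def[symmetric] using n by (simp_all add: field_simps)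
qed

text \<open>The coefficient vector is v + ((p \<bullet> v) / n) p, and the radial corrections
  contained in the frame fields remove exactly the surplus multiple of p.\<close>

lemma frame_expansion:
  assumes "p \<noteq> 0"
  shows "v = cone_metric p (frame1 p) v *\<^sub>R frame1 p + cone_metric p (frame2 p) v *\<^sub>R frame2 p"
    (is "v = ?a *\<^sub>R _ + ?b *\<^sub>R _")
proof -
  define n where "n = p \<bullet> p"
  have n: "n \<noteq> 0" using assms by (simp add: n_def)
  have pf: "p \<bullet> frame1 p = fst p / 2" "p \<bullet> frame2 p = snd p / 2"
    unfolding frame_eq[OF assms] inner_diff_right inner_scaleR_right n_def[symmetric]
    using n by (cases p; simp)+
  have fv: "frame1 p \<bullet> v = fst v - fst p * (p \<bullet> v) / (2 * n)"
      "frame2 p \<bullet> v = snd v - snd p * (p \<bullet> v) / (2 * n)"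
    unfolding frame_eq[OF assms] inner_diff_left inner_scaleR_left n_def[symmetric]
    using n by (cases v; simp add: field_simps)+
  have a: "?a = fst v + fst p * (p \<bullet> v) / n" "?b = snd v + snd p * (p \<bullet> v) / n"
    unfolding cone_metric_eq[OF assms] pf fv n_def[symmetric] using n by (simp_all add: field_simps)
  have "fst p * ?a + snd p * ?b = p \<bullet> v + (p \<bullet> p) * (p \<bullet> v) / n"
    unfolding a by (cases p; cases v) (simp add: add_divide_distrib algebra_simps)
  then have s: "fst p * ?a + snd p * ?b = 2 * (p \<bullet> v)"
    using n by (simp add: n_def[symmetric])
  have "?a *\<^sub>R frame1 p + ?b *\<^sub>R frame2 p
      = (?a, ?b) - ((fst p * ?a + snd p * ?b) / (2 * n)) *\<^sub>R p"
  proof -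
    have "a *\<^sub>R frame1 p + b *\<^sub>R frame2 p = (a, b) - ((fst p * a + snd p * b) / (2 * n)) *\<^sub>R p" for a b
    proof -
      have "(a, b) = a *\<^sub>R (1, 0) + b *\<^sub>R (0, 1)" by simp
      moreover have "(fst p * a + snd p * b) / (2 * n)
          = a * (fst p / 2 * inverse n) + b * (snd p / 2 * inverse n)"
        using n by (simp add: field_simps)
      ultimately show ?thesis
        unfolding frame_eq[OF assms] n_def[symmetric]
        by (simp only: scaleR_diff_right scaleR_scaleR scaleR_add_left) simp
    qed
    then show ?thesis .
  qed
  also have "\<dots> = v"
    unfolding s unfolding a using n by (cases p; cases v) (simp add: field_simps)
  finally show ?thesis by simp
qed

text \<open>
  The difference tensor of two Levi-Civita connections, paired with the metric, is symmetric in
  its first two and antisymmetric in its last two arguments, hence zero.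
\<close>

lemma levi_civita_on_cone_unique:
  assumes D: "levi_civita_on punctured_plane cone_metric D"
    and E: "levi_civita_on punctured_plane cone_metric E"
    and "smooth_on punctured_plane X" "smooth_on punctured_plane Y" "p \<in> punctured_plane"
  shows "D X Y p = E X Y p"
proof -
  let ?S = "smooth_on punctured_plane"
  have p: "p \<noteq> 0" using assms by simp
  define T where "T X Y Z = cone_metric p (D X Y p - E X Y p) (Z p)" for X Y Z
  have sym: "T X Y Z = T Y X Z" if "?S X" "?S Y" for X Y Z
  proof -
    have "D X Y p - D Y X p = E X Y p - E Y X p"
      using D E that assms(5) by (simp add: levi_civita_on_def)
    then have "D X Y p - E X Y p = D Y X p - E Y X p"
      by (simp add: algebra_simps)
    then show ?thesis by (simp add: T_def)
  qed
  have anti: "T X Y Z = - T X Z Y" if "?S X" "?S Y" "?S Z" for X Y Z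
  proof -
    have "cone_metric p (D X Y p) (Z p) + cone_metric p (Y p) (D X Z p) =
        cone_metric p (E X Y p) (Z p) + cone_metric p (Y p) (E X Z p)"
      using D[unfolded levi_civita_on_def] E[unfolded levi_civita_on_def] that assms(5) by simp
    then show ?thesis
      by (simp add: T_def cone_metric_linear[OF p] cone_metric_commute[OF p, of "Y p"])
  qed
  \<comment> \<open>The difference vector at \<open>p\<close> is extended to a constant, hence
    smooth, field; \<open>T X Y Z\<close> is then its squared length, so definiteness finishes the
    proof.\<close>
  define Z where "Z = (\<lambda>_::plane. D X Y p - E X Y p)"
  have Z: "?S Z" unfolding Z_def smooth_on_def by (auto intro: Ck_on_const)
  have "T X Y Z = 0"
  proof -
    have "T X Y Z = - T Z X Y"
      using anti[of X Y Z] sym[of X Z Y] assms(3,4) Z by simp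
    also have "\<dots> = T Y Z X"
      using anti[of Z X Y] sym[of Z Y X] assms(3,4) Z by simp
    also have "\<dots> = - T X Y Z"
      using anti[of Y Z X] sym[of Y X Z] assms(3,4) Z by simp
    finally show ?thesis by simp
  qed
  then have "D X Y p - E X Y p = 0"
    using cone_metric_definite[OF p] unfolding T_def Z_def by blast
  then show ?thesis by simp
qed

text \<open>Uniqueness replaces \<open>D\<close> by the explicit connection. The covariant
  derivative of \<open>frame2\<close> is then a combination of \<open>X p\<close> and
  \<open>p\<close>, and pairing it with \<open>frame1\<close> leaves only the component of
  \<open>X p\<close> along \<open>rot p\<close>.\<close>

lemma connection_form_eq:
  assumes "levi_civita_on punctured_plane cone_metric D" "smooth_on punctured_plane X" "p \<noteq> 0"
  shows "connection_form D X p = 1 / 2 * angular_form X p"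
proof -
  have DE: "D X frame2 p = cone_connection X frame2 p"
    using levi_civita_on_cone_unique[OF assms(1) levi_civita_on_cone_connection assms(2)]
      smooth_on_frame assms(3) by simp
  have pp: "p \<bullet> p \<noteq> 0" using assms(3) by simp
  let ?c = "\<lambda>q. snd q / (2 * (q \<bullet> q))"
  let ?c' = "\<lambda>u. snd u / (2 * (p \<bullet> p)) - snd p * (p \<bullet> u) / ((p \<bullet> p) * (p \<bullet> p))"
  let ?F' = "\<lambda>u. - (?c p *\<^sub>R u + ?c' u *\<^sub>R p)"
  have "2 * (p \<bullet> p) \<noteq> 0" using pp by simp
  then have "(?c has_derivative ?c') (at p)"
    by (auto intro!: derivative_eq_intros simp: fun_eq_iff inner_commute field_simps)
  from has_derivative_diff[OF has_derivative_const has_derivative_scaleR[OF this has_derivative_ident]]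
  have "((\<lambda>q. (0, 1) - ?c q *\<^sub>R q) has_derivative ?F') (at p)"
    by simp
  moreover have "(0, 1) - ?c q *\<^sub>R q = frame2 q" if "q \<in> punctured_plane" for q
    using that by (simp only: frame_eq Compl_iff singleton_iff not_False_eq_True divide_inverse
        inverse_mult_distrib mult.assoc)
  ultimately have "(frame2 has_derivative ?F') (at p)"
    using has_derivative_transform_within_open[of _ ?F' p UNIV punctured_plane frame2] assms(3) by blast
  then have d: "dirderiv X frame2 p = ?F' (X p)"
    unfolding dirderiv_def by (simp add: frechet_derivative_eqI)
  define x y n q m where "x = fst p" "y = snd p" "n = p \<bullet> p" "q = p \<bullet> X p" "m = rot p \<bullet> X p"
  note defs = \<open>x = _\<close> \<open>y = _\<close> \<open>n = _\<close> \<open>q = _\<close> \<open>m = _\<close>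
  have n: "n \<noteq> 0" using pp \<open>n = _\<close> by simp
  have pf: "p \<bullet> frame1 p = x / 2"
    unfolding frame_eq[OF assms(3)] inner_diff_right inner_scaleR_right defs(3)[symmetric]
    using n by (cases p) (simp add: defs)
  have fv: "frame1 p \<bullet> v = fst v - x * (p \<bullet> v) / (2 * n)" for v
    unfolding frame_eq[OF assms(3)] inner_diff_left inner_scaleR_left defs(3)[symmetric] defs(1)[symmetric]
    using n by (cases v) (simp add: field_simps)
  \<comment> \<open>Pairing with \<open>frame1\<close> becomes a linear functional in Cartesian
    terms, so that \<open>frame1\<close> itself disappears from the computation.\<close>
  have g: "cone_metric p (frame1 p) v = fst v + x * (p \<bullet> v) / n" for v
    unfolding cone_metric_eq[OF assms(3)] pf fv defs(3)[symmetric]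
    using n by (simp add: field_simps)
  have "rot p \<bullet> p = 0"
    by (cases p) (simp add: rot_def)
  moreover have "rot p \<bullet> (0, 1) = x"
    by (simp add: rot_def defs)
  ultimately have rf: "rot p \<bullet> frame2 p = x"
    unfolding frame_eq[OF assms(3)] inner_diff_right inner_scaleR_right by simp
  have m: "m = x * snd (X p) - y * fst (X p)"
    by (cases "X p") (simp add: rot_def defs)
  \<comment> \<open>Second component of n X = q p + m \<open>rot p\<close>, the decomposition of
    \<open>X p\<close> in the orthogonal basis p, \<open>rot p\<close>.\<close>
  have nX: "n * snd (X p) = y * q + x * m"
    unfolding defs by (cases p; cases "X p") (simp add: rot_def algebra_simps)
  \<comment> \<open>The coefficient of p: the Christoffel term minus the derivative of the radial
    correction in \<open>frame2\<close>.\<close>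
  define k where "k = 3 / 4 * (m * x) * (inverse n * inverse n) - (snd (X p) / (2 * n) - y * q / (n * n))"
  have "cone_connection X frame2 p = (- (y / (2 * n))) *\<^sub>R X p + k *\<^sub>R p"
    unfolding cone_connection_def d rf k_def defs(2,3,4,5)[symmetric]
    by (simp add: scaleR_diff_left)
  then have "connection_form D X p = - (y / (2 * n)) * fst (X p) + k * x
      + x * (- (y / (2 * n)) * q + k * n) / n"
    by (simp add: connection_form_def DE g inner_diff_right defs)
  also have "\<dots> = (3 * x * (y * q + x * m) / n - 2 * x * snd (X p) - y * fst (X p)) / (2 * n)"
    unfolding k_def using n by (simp add: field_simps)
  also have "\<dots> = m / (2 * n)"
    unfolding nX[symmetric] unfolding m using n by (simp add: field_simps)
  also have "\<dots> = 1 / 2 * angular_form X p"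
    unfolding angular_form_def m by (simp add: defs dot_square_norm)
  finally show ?thesis .
qed

text \<open>The angular field is \<open>rot p\<close>, orthogonal to p, so the cone term drops out
  and the metric acts on it as the Euclidean one.\<close>

lemma cone_metric_d_phi:
  assumes "p \<noteq> 0"
  shows "cone_metric p (d_phi p) v = rot p \<bullet> v"
proof -
  have "d_phi p = rot p"
    using assms by (simp add: d_phi_def d_x_def d_y_def cos_phi_def sin_phi_def rot_def)
  moreover have "p \<bullet> rot p = 0"
    by (cases p) (simp add: rot_def)
  ultimately show ?thesis
    by (simp add: cone_metric_eq[OF assms])
qed

section \<open>Closedness of the angular form and flatness away from the origin\<close>

lemma smooth_on_lie_bracket:
  assumes "smooth_on punctured_plane X" "smooth_on punctured_plane Y"
  shows "smooth_on punctured_plane (lie_bracket X Y)"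
proof -
  have S: "open punctured_plane" by auto
  have "smooth_on punctured_plane (\<lambda>p. dirderiv X Y p + - dirderiv Y X p)"
    using smooth_on_dirderiv[OF S assms] smooth_on_dirderiv[OF S assms(2,1)]
    unfolding smooth_on_def
    by (intro allI Ck_on_add[OF S] Ck_on_linear[OF S bounded_linear_minus[OF bounded_linear_ident]]) auto
  then show ?thesis
    by (simp add: lie_bracket_def[abs_def])
qed

text \<open>Functions agreeing near p have the same derivatives there, and
  \<open>frechet_derivative\<close> is a choice depending only on that predicate; equality therefore
  also covers functions without a derivative at p.\<close>

lemma dirderiv_cong:
  assumes "open S" "p \<in> S" "\<And>q. q \<in> S \<Longrightarrow> f q = g q"
  shows "dirderiv X f p = dirderiv X g p"
proof -
  have "(f has_derivative F) (at p) \<longleftrightarrow> (g has_derivative F) (at p)" for F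
    using has_derivative_transform_within_open[OF _ assms(1,2)] assms(3) by metis
  then show ?thesis
    by (simp add: dirderiv_def frechet_derivative_def)
qed

lemma angular_form_eq: "angular_form X p = (rot p \<bullet> X p) / (p \<bullet> p)"
  by (cases "X p") (simp add: angular_form_def rot_def dot_square_norm)

lemma dirderiv_cmult:
  fixes f :: "'a::real_normed_vector \<Rightarrow> real"
  assumes "f differentiable at p"
  shows "dirderiv X (\<lambda>q. c * f q) p = c * dirderiv X f p"
  using frechet_derivative_eqI[OF has_derivative_mult_right[of f _ "at p" c]] assms
  by (simp add: dirderiv_def frechet_derivative_works)

lemma has_derivative_angular_form:
  assumes "p \<noteq> 0" and Y: "(Y has_derivative Y') (at p)"
  shows "(angular_form Y has_derivative (\<lambda>u. (rot u \<bullet> Y p + rot p \<bullet> Y' u) / (p \<bullet> p)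
      - 2 * (rot p \<bullet> Y p) * (p \<bullet> u) / ((p \<bullet> p) * (p \<bullet> p)))) (at p)"
proof -
  note R = bounded_linear.has_derivative[OF bounded_linear_rot has_derivative_ident]
  have pp: "p \<bullet> p \<noteq> 0" using assms(1) by simp
  show ?thesis
    unfolding angular_form_eq[abs_def]
    by (rule derivative_eq_intros R Y refl pp)+
      (use pp in \<open>simp add: fun_eq_iff inner_commute field_simps\<close>)
qed

text \<open>The derivatives of the two fields cancel against the bracket. What remains vanishes
  algebraically: with d = det(X, Y) at p, \<open>rot X \<bullet> Y - rot Y \<bullet> X\<close> is 2
  d, and the antisymmetrised products of \<open>rot p\<close> and p are n d.\<close>

lemma ext_deriv_angular_form:
  assumes "p \<noteq> 0" and X: "(X has_derivative X') (at p)" and Y: "(Y has_derivative Y') (at p)"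
  shows "ext_deriv angular_form X Y p = 0"
proof -
  define n where "n = p \<bullet> p"
  have n: "n \<noteq> 0" using assms(1) by (simp add: n_def)
  have L: "lie_bracket X Y p = Y' (X p) - X' (Y p)"
    by (simp add: lie_bracket_def dirderiv_def frechet_derivative_eqI[OF X] frechet_derivative_eqI[OF Y])
  have "ext_deriv angular_form X Y p =
      ((rot (X p) \<bullet> Y p + rot p \<bullet> Y' (X p)) / n - 2 * (rot p \<bullet> Y p) * (p \<bullet> X p) / (n * n))
    - ((rot (Y p) \<bullet> X p + rot p \<bullet> X' (Y p)) / n - 2 * (rot p \<bullet> X p) * (p \<bullet> Y p) / (n * n))
    - (rot p \<bullet> Y' (X p) - rot p \<bullet> X' (Y p)) / n"
    unfolding ext_deriv_def dirderiv_def
      frechet_derivative_eqI[OF has_derivative_angular_form[OF assms(1) X]]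
      frechet_derivative_eqI[OF has_derivative_angular_form[OF assms(1) Y]]
      angular_form_eq L n_def inner_diff_right ..
  also have "\<dots> = (n * (rot (X p) \<bullet> Y p - rot (Y p) \<bullet> X p)
      - 2 * ((rot p \<bullet> Y p) * (p \<bullet> X p) - (rot p \<bullet> X p) * (p \<bullet> Y p))) / (n * n)"
    using n by (simp add: field_simps)
  also have "n * (rot (X p) \<bullet> Y p - rot (Y p) \<bullet> X p)
      - 2 * ((rot p \<bullet> Y p) * (p \<bullet> X p) - (rot p \<bullet> X p) * (p \<bullet> Y p)) = 0"
    unfolding n_def by (cases p; cases "X p"; cases "Y p") (simp add: rot_def algebra_simps)
  finally show ?thesis by simp
qed

lemma ext_deriv_connection_form:
  assumes D: "levi_civita_on punctured_plane cone_metric D"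
    and X: "smooth_on punctured_plane X" and Y: "smooth_on punctured_plane Y" and "p \<noteq> 0"
  shows "ext_deriv (connection_form D) X Y p = 0"
proof -
  have dd: "angular_form Z differentiable at p" if "smooth_on punctured_plane Z" for Z
    using has_derivative_angular_form[OF assms(4) smooth_on_derivative[OF that]] assms(4)
    by (auto simp: differentiable_def)
  have d: "dirderiv W (connection_form D Z) p = 1 / 2 * dirderiv W (angular_form Z) p"
    if "smooth_on punctured_plane Z" for W Z
  proof -
    have "dirderiv W (connection_form D Z) p = dirderiv W (\<lambda>q. 1 / 2 * angular_form Z q) p"
      by (rule dirderiv_cong[of punctured_plane])
        (use assms(4) connection_form_eq[OF D that] in auto)
    then show ?thesis
      by (simp only: dirderiv_cmult[OF dd[OF that]])
  qed
  have "ext_deriv (connection_form D) X Y p = 1 / 2 * ext_deriv angular_form X Y p"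
    unfolding ext_deriv_def d[OF X] d[OF Y]
      connection_form_eq[OF D smooth_on_lie_bracket[OF X Y] assms(4)] by simp
  also have "\<dots> = 0"
    using ext_deriv_angular_form[OF assms(4) smooth_on_derivative[OF X] smooth_on_derivative[OF Y]]
      assms(4) by simp
  finally show ?thesis .
qed

text \<open>Each frame field is orthogonal to its own covariant derivative. Hence the derivative of
  e_2 is \<omega> e_1, and in a second differentiation only the derivative of the coefficient
  survives pairing with e_1. Antisymmetrising and subtracting the bracket term gives the invariant
  formula for d\<omega>.\<close>

lemma curvature_form_eq_ext_deriv:
  assumes D: "levi_civita_on punctured_plane cone_metric D"
    and X: "smooth_on punctured_plane X" and Y: "smooth_on punctured_plane Y" and "p \<noteq> 0"
  shows "curvature_form D X Y p = ext_deriv (connection_form D) X Y p"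
proof -
  let ?S = "smooth_on punctured_plane"
  let ?C = cone_connection and ?\<omega> = "connection_form D"
  note sf = smooth_on_frame
  have unit: "cone_metric q (frame q) (D W frame q) = 0"
    if "?S W" "q \<noteq> 0" "?S frame" "\<And>q. q \<noteq> 0 \<Longrightarrow> cone_metric q (frame q) (frame q) = 1"
    for W q and frame :: "plane vfield"
  proof -
    have "dirderiv W (\<lambda>q. cone_metric q (frame q) (frame q)) q = dirderiv W (\<lambda>q. 1::real) q"
      by (rule dirderiv_cong[of punctured_plane]) (use that in auto)
    then have "dirderiv W (\<lambda>q. cone_metric q (frame q) (frame q)) q = 0"
      by (simp add: dirderiv_def)
    moreover have "dirderiv W (\<lambda>q. cone_metric q (frame q) (frame q)) q =
        cone_metric q (D W frame q) (frame q) + cone_metric q (frame q) (D W frame q)"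
      using D that unfolding levi_civita_on_def by auto
    ultimately show ?thesis
      using cone_metric_commute[OF that(2)] by simp
  qed
  have D2: "D W frame2 q = ?\<omega> W q *\<^sub>R frame1 q" if "?S W" "q \<noteq> 0" for W q
  proof -
    have "D W frame2 q = ?\<omega> W q *\<^sub>R frame1 q + cone_metric q (frame2 q) (D W frame2 q) *\<^sub>R frame2 q"
      unfolding connection_form_def by (rule frame_expansion[OF that(2)])
    then show ?thesis
      using unit[OF that sf(2)] frame_orthonormal by simp
  qed
  have DD: "cone_metric p (D V (D W frame2) p) (frame1 p) = dirderiv V (?\<omega> W) p"
    if V: "?S V" and W: "?S W" for V W
  proof -
    have sW: "?S (D W frame2)"
      by (rule D[unfolded levi_civita_on_def affine_connection_on_def, THEN conjunct1, THEN conjunct1,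
            rule_format, OF W sf(2)])
    have h: "(?\<omega> W has_derivative frechet_derivative (?\<omega> W) (at p)) (at p)"
    proof -
      have "(angular_form W has_derivative frechet_derivative (angular_form W) (at p)) (at p)"
        using has_derivative_angular_form[OF assms(4) smooth_on_derivative[OF W]] assms(4)
        by (auto simp: frechet_derivative_works[symmetric] differentiable_def)
      then have "((\<lambda>q. 1 / 2 * angular_form W q) has_derivative
          (\<lambda>u. 1 / 2 * frechet_derivative (angular_form W) (at p) u)) (at p)"
        by (rule has_derivative_mult_right)
      then have "(?\<omega> W has_derivative (\<lambda>u. 1 / 2 * frechet_derivative (angular_form W) (at p) u)) (at p)"
        by (rule has_derivative_transform_within_open[of _ _ _ _ punctured_plane])
          (use assms(4) connection_form_eq[OF D W] in auto)
      then show ?thesis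
        using frechet_derivative_works differentiable_def by blast
    qed
    have e: "(frame1 has_derivative frechet_derivative frame1 (at p)) (at p)"
      using smooth_on_derivative[OF sf(1)] assms(4) by simp
    \<comment> \<open>The product rule is taken through the explicit connection, which sees its
      second argument only through its value and derivative at \<open>p\<close>; differentiability
      of the coefficient at \<open>p\<close>, known from \<open>h\<close>, is then enough.\<close>
    have "dirderiv V (D W frame2) p = dirderiv V (\<lambda>q. ?\<omega> W q *\<^sub>R frame1 q) p"
      by (rule dirderiv_cong[of punctured_plane]) (use D2[OF W] assms(4) in auto)
    also have "\<dots> = dirderiv V (?\<omega> W) p *\<^sub>R frame1 p + ?\<omega> W p *\<^sub>R dirderiv V frame1 p"
      using frechet_derivative_eqI[OF has_derivative_scaleR[OF h e]] by (simp add: dirderiv_def)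
    finally have "?C V (D W frame2) p = dirderiv V (?\<omega> W) p *\<^sub>R frame1 p + ?\<omega> W p *\<^sub>R ?C V frame1 p"
      unfolding cone_connection_def D2[OF W assms(4)] by (simp add: algebra_simps)
    moreover have "D V (D W frame2) p = ?C V (D W frame2) p" "D V frame1 p = ?C V frame1 p"
      using levi_civita_on_cone_unique[OF D levi_civita_on_cone_connection V] sW sf assms(4) by auto
    ultimately have "D V (D W frame2) p = dirderiv V (?\<omega> W) p *\<^sub>R frame1 p + ?\<omega> W p *\<^sub>R D V frame1 p"
      by simp
    moreover have "cone_metric p (D V frame1 p) (frame1 p) = 0"
      using unit[OF V assms(4) sf(1)] frame_orthonormal cone_metric_commute[OF assms(4)] by simp
    ultimately show ?thesis
      using frame_orthonormal(1)[OF assms(4)] by (simp add: cone_metric_linear[OF assms(4)])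
  qed
  show ?thesis
    unfolding curvature_form_def curvature_tensor_def cone_metric_linear[OF assms(4)] ext_deriv_def
      DD[OF X Y] DD[OF Y X]
    by (simp add: connection_form_def cone_metric_commute[OF assms(4)])
qed

section \<open>The radial derivative integrated against the inverse square\<close>

text \<open>Lebesgue measure is its own image under scaling, reweighted by the Jacobian. The
  integral formula includes non-integrable functions, for which both sides take the default value
  0.\<close>

lemma
  fixes f :: "'a::euclidean_space \<Rightarrow> 'b::{banach, second_countable_topology}"
  assumes [measurable]: "f \<in> borel_measurable borel" and "c \<noteq> 0"
  shows lborel_integrable_scaleR_iff:
      "integrable lborel f \<longleftrightarrow> integrable lborel (\<lambda>x. f (c *\<^sub>R x))"
    and lborel_integral_scaleR:
      "integral\<^sup>L lborel f = \<bar>c\<bar> ^ DIM('a) *\<^sub>R integral\<^sup>L lborel (\<lambda>x. f (c *\<^sub>R x))"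
proof -
  have eq: "lborel = density (distr lborel borel (\<lambda>x::'a. c *\<^sub>R x)) (\<lambda>_. ennreal (\<bar>c\<bar> ^ DIM('a)))"
    using lborel_affine[OF assms(2), of "0::'a"] by (simp add: ennreal_power)
  show "integrable lborel f \<longleftrightarrow> integrable lborel (\<lambda>x. f (c *\<^sub>R x))"
  proof -
    have "integrable lborel f \<longleftrightarrow> integrable lborel (\<lambda>x. \<bar>c\<bar> ^ DIM('a) *\<^sub>R f (c *\<^sub>R x))"
      by (subst eq, subst integrable_density) (auto simp: integrable_distr_eq)
    moreover have "integrable lborel (\<lambda>x. f (c *\<^sub>R x))"
      if "integrable lborel (\<lambda>x. \<bar>c\<bar> ^ DIM('a) *\<^sub>R f (c *\<^sub>R x))"
      using integrable_scaleR_right[of "inverse (\<bar>c\<bar> ^ DIM('a))", OF that] assms(2) by simp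
    moreover have "integrable lborel (\<lambda>x. \<bar>c\<bar> ^ DIM('a) *\<^sub>R f (c *\<^sub>R x))"
      if "integrable lborel (\<lambda>x. f (c *\<^sub>R x))"
      using integrable_scaleR_right[OF that] by blast
    ultimately show ?thesis by blast
  qed
  show "integral\<^sup>L lborel f = \<bar>c\<bar> ^ DIM('a) *\<^sub>R integral\<^sup>L lborel (\<lambda>x. f (c *\<^sub>R x))"
    by (subst eq, subst integral_density) (auto simp: integral_distr)
qed

text \<open>The antiderivative -1 / (2 t^2) vanishes at infinity. With a = |q| this supplies the
  inverse square weight, up to a factor 2.\<close>

lemma has_bochner_integral_inverse_cube:
  assumes "(a::real) > 0"
  shows "has_bochner_integral lborel (\<lambda>t. inverse (t ^ 3) * indicator {a..} t) (inverse (2 * a\<^sup>2))"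
proof (rule has_bochner_integral_nn_integral)
  have "((\<lambda>t::real. - inverse (2 * t\<^sup>2)) \<longlongrightarrow> 0) at_top"
    by real_asymp
  then have "(\<integral>\<^sup>+t. ennreal (inverse (t ^ 3)) * indicator {a..} t \<partial>lborel) = ennreal (0 - (- inverse (2 * a\<^sup>2)))"
    using assms
    by (intro nn_integral_FTC_atLeast)
      (auto intro!: derivative_eq_intros simp: field_simps power2_eq_square power3_eq_cube)
  then show "(\<integral>\<^sup>+t. ennreal (inverse (t ^ 3) * indicator {a..} t) \<partial>lborel) = ennreal (inverse (2 * a\<^sup>2))"
    by (simp add: ennreal_mult' ennreal_indicator mult.commute)
qed (use assms in \<open>auto split: split_indicator\<close>)

text \<open>The class C^1 with compact support, with the derivative carried along explicitly.
  Continuity in each fixed direction becomes joint continuity through the coordinate expansion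
  \<open>coords\<close>.\<close>

locale plane_test_function =
  fixes \<eta> :: "plane \<Rightarrow> real" and \<eta>' :: "plane \<Rightarrow> plane \<Rightarrow> real"
  assumes deriv: "(\<eta> has_derivative \<eta>' p) (at p)"
    and cont: "continuous_on UNIV (\<lambda>p. \<eta>' p v)"
    and supp: "compact (closure {p. \<eta> p \<noteq> 0})"
begin

section \<open>Bounds on the derivative and integration along rays\<close>

lemma coords: "\<eta>' p v = fst v * \<eta>' p (1, 0) + snd v * \<eta>' p (0, 1)"
proof -
  interpret linear "\<eta>' p"
    using deriv by (rule has_derivative_linear)
  have "v = fst v *\<^sub>R (1, 0) + snd v *\<^sub>R (0, 1)"
    by (cases v) simp
  then show ?thesis
    by (metis add scale real_scaleR_def)
qed

lemma continuous_on_deriv [continuous_intros]: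
  assumes "continuous_on S f" "continuous_on S g"
  shows "continuous_on S (\<lambda>x. \<eta>' (f x) (g x))"
proof -
  have "continuous_on S (\<lambda>x. \<eta>' (f x) v)" for v
    using continuous_on_compose2[OF cont assms(1)] by auto
  then show ?thesis
    unfolding coords[of _ "g _"] using assms(2) by (intro continuous_intros) auto
qed

lemma bounded_support:
  obtains R where "R > 0" "\<And>p. norm p > R \<Longrightarrow> \<eta> p = 0" "\<And>p v. norm p > R \<Longrightarrow> \<eta>' p v = 0"
proof -
  obtain R where R: "R > 0" "\<And>p. p \<in> closure {p. \<eta> p \<noteq> 0} \<Longrightarrow> norm p \<le> R"
    using compact_imp_bounded[OF supp] unfolding bounded_pos by blast
  have zero: "\<eta> p = 0" if "norm p > R" for p
    using R(2)[of p] closure_subset[of "{p. \<eta> p \<noteq> 0}"] that by force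
  have "\<eta>' p v = 0" if "norm p > R" for p v
  proof -
    have "open {p::plane. norm p > R}"
      by (intro open_Collect_less continuous_intros)
    then have "((\<lambda>_. 0) has_derivative \<eta>' p) (at p)"
      using has_derivative_transform_within_open[OF deriv, of "{p. norm p > R}" p "\<lambda>_. 0"] zero that by auto
    then have "\<eta>' p = (\<lambda>_. 0)"
      using has_derivative_unique has_derivative_const by blast
    then show ?thesis by simp
  qed
  with R(1) zero that show ?thesis by blast
qed

text \<open>In a fixed direction the derivative is continuous on a compact ball and zero outside it;
  the two coordinate directions then control all vectors.\<close>

lemma bounded_derivative:
  obtains C where "C \<ge> 0" "\<And>p v. \<bar>\<eta>' p v\<bar> \<le> C * norm v"
proof -
  obtain R where R: "R > 0" "\<And>p v. norm p > R \<Longrightarrow> \<eta>' p v = 0"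
    using bounded_support by metis
  have "\<exists>B. B \<ge> 0 \<and> (\<forall>p. \<bar>\<eta>' p v\<bar> \<le> B)" for v
  proof -
    have "compact ((\<lambda>p. \<eta>' p v) ` cball 0 R)"
      by (intro compact_continuous_image continuous_on_subset[OF cont]) auto
    then obtain B where B: "B > 0" "\<And>p. p \<in> cball 0 R \<Longrightarrow> \<bar>\<eta>' p v\<bar> \<le> B"
      by (auto simp: bounded_pos dest!: compact_imp_bounded)
    have "\<bar>\<eta>' p v\<bar> \<le> B" for p
      using B R(2)[of p v] by (cases "norm p > R") auto
    with B(1) show ?thesis by (intro exI[of _ B]) auto
  qed
  then obtain B where B: "\<And>v. B v \<ge> 0" "\<And>p v. \<bar>\<eta>' p v\<bar> \<le> B v"
    by metis
  have "\<bar>\<eta>' p v\<bar> \<le> (B (1, 0) + B (0, 1)) * norm v" for p v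
  proof -
    have "\<bar>fst v\<bar> \<le> norm v" "\<bar>snd v\<bar> \<le> norm v"
      using norm_fst_le[of "fst v" "snd v"] norm_snd_le[of "snd v" "fst v"] by auto
    then have "\<bar>fst v\<bar> * \<bar>\<eta>' p (1, 0)\<bar> \<le> norm v * B (1, 0)" "\<bar>snd v\<bar> * \<bar>\<eta>' p (0, 1)\<bar> \<le> norm v * B (0, 1)"
      by (auto intro!: mult_mono B)
    then show ?thesis
      unfolding coords[of p v] abs_mult[symmetric] by (simp add: algebra_simps)
  qed
  with that[of "B (1, 0) + B (0, 1)"] B(1) show ?thesis by simp
qed

text \<open>Fundamental theorem of calculus along the ray through \<open>p\<close>, which starts at
  the origin and leaves the support because \<open>p\<close> is nonzero.\<close>

lemma ray_integral:
  assumes "p \<noteq> 0"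
  shows "has_bochner_integral lborel (\<lambda>t. indicator {0..} t * \<eta>' (t *\<^sub>R p) p) (- \<eta> 0)"
proof -
  obtain R where R: "R > 0" "\<And>p. norm p > R \<Longrightarrow> \<eta> p = 0" "\<And>p v. norm p > R \<Longrightarrow> \<eta>' p v = 0"
    using bounded_support by metis
  \<comment> \<open>Chosen so that \<open>T *\<^sub>R p\<close> has norm R + 1; beyond
    \<open>T\<close> the integrand vanishes, so truncating there loses nothing.\<close>
  define T where "T = (R + 1) / norm p"
  have T: "T > 0" "T * norm p > R"
    using R(1) assms by (simp_all add: T_def)
  have "((\<lambda>t. \<eta> (t *\<^sub>R p)) has_vector_derivative \<eta>' (t *\<^sub>R p) p) (at t within {0..T})" for t
  proof -
    have "((\<lambda>t. \<eta> (t *\<^sub>R p)) has_derivative (\<lambda>h. \<eta>' (t *\<^sub>R p) (h *\<^sub>R p))) (at t)"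
      by (rule has_derivative_compose[OF _ deriv]) (auto intro!: derivative_eq_intros)
    moreover have "\<eta>' (t *\<^sub>R p) (h *\<^sub>R p) = h *\<^sub>R \<eta>' (t *\<^sub>R p) p" for h
      using linear_scale[OF has_derivative_linear[OF deriv]] by simp
    ultimately show ?thesis
      by (simp add: has_vector_derivative_def has_derivative_at_withinI)
  qed
  then have "has_bochner_integral lborel (\<lambda>t. indicator {0..T} t *\<^sub>R \<eta>' (t *\<^sub>R p) p)
      (\<eta> (T *\<^sub>R p) - \<eta> (0 *\<^sub>R p))"
    using T(1) by (intro has_bochner_integral_FTC_Icc continuous_intros) auto
  moreover have zero: "\<eta> (T *\<^sub>R p) = 0"
    using T by (intro R(2)) simp
  moreover have eq: "indicator {0..T} t *\<^sub>R \<eta>' (t *\<^sub>R p) p = indicator {0..} t * \<eta>' (t *\<^sub>R p) p" for t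
  proof (cases "t \<le> T")
    case False
    then have "norm (t *\<^sub>R p) > R"
      using T mult_right_mono[of T t "norm p"] by simp
    then show ?thesis by (simp add: R(3))
  qed (auto split: split_indicator)
  ultimately show ?thesis
    unfolding eq zero by simp
qed

text \<open>Absolute integrability is established for \<open>?K\<close>, on the product of the disc
  and the half line, and carried over to \<open>?G\<close>, on the region |q| \<le> t, slice by
  slice in t. Fubini then evaluates \<open>?K\<close> along rays and \<open>?G\<close> along the
  t-axis.\<close>

lemma radial_integral:
  "has_bochner_integral lborel (\<lambda>q. \<eta>' q q / (norm q)\<^sup>2) (- 2 * pi * \<eta> 0)"
proof -
  let ?K = "\<lambda>(p::plane, t::real). indicator (cball 0 1) p * (indicator {0..} t * \<eta>' (t *\<^sub>R p) p)"
  let ?G = "\<lambda>(q::plane, t::real). indicator {x. norm (fst x) \<le> snd x} (q, t) * (inverse (t ^ 3) * \<eta>' q q)"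
  have Q [measurable]: "(\<lambda>q. \<eta>' q q) \<in> borel_measurable borel"
    by (intro borel_measurable_continuous_onI continuous_intros)
  have "(\<lambda>x. \<eta>' (snd x *\<^sub>R fst x) (fst x)) \<in> borel_measurable borel"
    by (intro borel_measurable_continuous_onI continuous_intros)
  then have P [measurable]: "(\<lambda>x. \<eta>' (snd x *\<^sub>R fst x) (fst x)) \<in> borel_measurable (lborel \<Otimes>\<^sub>M lborel)"
    by (simp add: lborel_prod)
  have ind: "(\<lambda>x. indicator (cball 0 1) (fst x) :: real) \<in> borel_measurable (lborel \<Otimes>\<^sub>M lborel)"
      "(\<lambda>x. indicator {0::real..} (snd x) :: real) \<in> borel_measurable (lborel \<Otimes>\<^sub>M lborel)"
    by (rule measurable_compose[OF measurable_fst borel_measurable_indicator]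
        measurable_compose[OF measurable_snd borel_measurable_indicator]; simp add: borel_closed)+
  have K: "?K \<in> borel_measurable (lborel \<Otimes>\<^sub>M lborel)"
    unfolding case_prod_beta using ind P by (intro borel_measurable_times) auto
  have "closed {x::plane \<times> real. norm (fst x) \<le> snd x}"
    by (intro closed_Collect_le continuous_intros)
  then have "(indicator {x::plane \<times> real. norm (fst x) \<le> snd x} :: _ \<Rightarrow> real)
      \<in> borel_measurable (lborel \<Otimes>\<^sub>M lborel)"
    by (simp add: lborel_prod)
  moreover have "(\<lambda>x. inverse (snd x ^ 3) * \<eta>' (fst x) (fst x)) \<in> borel_measurable (lborel \<Otimes>\<^sub>M lborel)"
    by measurable
  ultimately have G: "?G \<in> borel_measurable (lborel \<Otimes>\<^sub>M lborel)"
    unfolding case_prod_beta by (intro borel_measurable_times) auto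
  obtain R where R: "R > 0" "\<And>p v. norm p > R \<Longrightarrow> \<eta>' p v = 0"
    using bounded_support by metis
  obtain C where C: "C \<ge> 0" "\<And>p v. \<bar>\<eta>' p v\<bar> \<le> C * norm v"
    using bounded_derivative by metis
  have K_fst: "has_bochner_integral lborel (\<lambda>t. ?K (p, t)) (indicator (cball 0 1) p * (- \<eta> 0))" if "p \<noteq> 0" for p
    using has_bochner_integral_mult_right[OF ray_integral[OF that]] by simp
  \<comment> \<open>At p = 0 the ray is a single point and its integral is 0 rather than
    \<open>- \<eta> 0\<close>, so the slice values hold only almost everywhere.\<close>
  have AE0: "AE p in lborel. p \<noteq> (0::plane)"
    by (rule AE_lborel_singleton)
  \<comment> \<open>The ray stays in the ball of radius R for time R / |p| with integrand at most C
    |p|, so the bound is uniform in p. Since the disc has finite area, this gives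
    integrability.\<close>
  have bound: "norm (\<integral>t. norm (?K (p, t)) \<partial>lborel) \<le> C * R" if "p \<noteq> 0" for p
  proof -
    have "(\<integral>t. norm (?K (p, t)) \<partial>lborel) \<le> (\<integral>t. indicator {0..R / norm p} t * (C * norm p) \<partial>lborel)"
    proof (rule integral_mono)
      show "integrable lborel (\<lambda>t. norm (?K (p, t)))"
        using K_fst[OF that] by (auto simp: has_bochner_integral_iff)
      show "norm (?K (p, t)) \<le> indicator {0..R / norm p} t * (C * norm p)" for t
      proof (cases "t \<in> {0..R / norm p}")
        case True
        then show ?thesis
          using C(2)[of "t *\<^sub>R p" p] C(1) by (auto simp: abs_mult split: split_indicator)
      next
        case False
        then have "t < 0 \<or> norm (t *\<^sub>R p) > R"
          using that by (auto simp: field_simps)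
        then show ?thesis
          using R(2)[of "t *\<^sub>R p" p] C(1) by (auto split: split_indicator)
      qed
    qed (intro integrable_mult_left integrable_real_indicator; simp add: emeasure_lborel_Icc_eq)
    also have "\<dots> = C * R"
      using that R(1) by simp
    finally show ?thesis
      using Bochner_Integration.integral_nonneg[of lborel "\<lambda>t. norm (?K (p, t))"]
      by (subst real_norm_def, subst abs_of_nonneg) auto
  qed
  have K_int: "integrable (lborel \<Otimes>\<^sub>M lborel) ?K"
  proof (rule lborel_pair.Fubini_integrable[OF K])
    show "integrable lborel (\<lambda>p. \<integral>t. norm (?K (p, t)) \<partial>lborel)"
    proof (rule integrableI_bounded_set[of "cball 0 1" _ _ "C * R"])
      show "AE p in lborel. p \<in> cball 0 1 \<longrightarrow> norm (\<integral>t. norm (?K (p, t)) \<partial>lborel) \<le> C * R"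
        using AE0 by eventually_elim (rule impI, rule bound)
      show "(\<lambda>p. \<integral>t. norm (?K (p, t)) \<partial>lborel) \<in> borel_measurable lborel"
        using measurable_compose[OF K borel_measurable_norm]
        by (intro lborel.borel_measurable_lebesgue_integral) (simp add: case_prod_unfold)
      show "emeasure lborel (cball (0::plane) 1) < \<infinity>"
        using emeasure_lborel_cball_finite[of "0::plane" 1] by simp
      show "AE p in lborel. p \<notin> cball 0 1 \<longrightarrow> (\<integral>t. norm (?K (p, t)) \<partial>lborel) = 0"
        by simp
    qed (simp add: borel_closed)
    show "AE p in lborel. integrable lborel (\<lambda>t. ?K (p, t))"
      using AE0 by eventually_elim (rule integrable.intros[OF K_fst])
  qed
  have "(\<integral>p. (\<integral>t. ?K (p, t) \<partial>lborel) \<partial>lborel) = (\<integral>p. indicator (cball 0 1) p * (- \<eta> 0) \<partial>(lborel::plane measure))"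
  proof (rule integral_cong_AE)
    show "(\<lambda>p. \<integral>t. ?K (p, t) \<partial>lborel) \<in> borel_measurable lborel"
      using K by (intro lborel.borel_measurable_lebesgue_integral) (simp add: case_prod_unfold)
    show "(\<lambda>p. indicator (cball 0 1) p * (- \<eta> 0)) \<in> borel_measurable (lborel::plane measure)"
      by (intro borel_measurable_times borel_measurable_indicator) (simp_all add: borel_closed)
    show "AE p in lborel. (\<integral>t. ?K (p, t) \<partial>lborel) = indicator (cball 0 1) p * (- \<eta> 0)"
      using AE0 by eventually_elim (rule has_bochner_integral_integral_eq[OF K_fst])
  qed
  also have "\<dots> = measure lborel (cball (0::plane) 1) * (- \<eta> 0)"
    by simp
  also have "\<dots> = - pi * \<eta> 0"
    by (subst content_cball) (simp_all add: unit_ball_vol_2)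
  finally have K_val: "integral\<^sup>L (lborel \<Otimes>\<^sub>M lborel) ?K = - pi * \<eta> 0"
    using lborel_pair.integral_fst'[OF K_int] by simp
  have AEt: "AE t in lborel. t \<noteq> (0::real)"
    by (rule AE_lborel_singleton)
  \<comment> \<open>The factor \<open>inverse (t\<^sup>2)\<close> left over here is cancelled by the
    two-dimensional Jacobian of q = t p. For negative t both kernels are zero.\<close>
  have GK: "?G (t *\<^sub>R p, t) = inverse (t\<^sup>2) * ?K (p, t)" if "t \<noteq> 0" for p t
  proof (cases "t > 0")
    case True
    have "\<eta>' (t *\<^sub>R p) (t *\<^sub>R p) = t * \<eta>' (t *\<^sub>R p) p"
      using linear_scale[OF has_derivative_linear[OF deriv]] by simp
    moreover have "norm (t *\<^sub>R p) \<le> t \<longleftrightarrow> norm p \<le> 1"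
      using True by simp
    ultimately show ?thesis
      using True by (simp add: indicator_def power2_eq_square power3_eq_cube)
  next
    case False
    then have "\<not> norm (t *\<^sub>R p) \<le> t"
      using that norm_ge_zero[of "t *\<^sub>R p"] by linarith
    then show ?thesis
      using False that by (simp add: indicator_def)
  qed
  have G_meas: "(\<lambda>q. ?G (q, t)) \<in> borel_measurable borel" for t
    using measurable_compose[OF measurable_Pair2' G, of t] by simp
  have G_int1: "integrable lborel (\<lambda>q. ?G (q, t)) \<longleftrightarrow> integrable lborel (\<lambda>p. ?K (p, t))"
    and G_int2: "(\<integral>q. ?G (q, t) \<partial>lborel) = (\<integral>p. ?K (p, t) \<partial>lborel)"
    and G_int3: "(\<integral>q. norm (?G (q, t)) \<partial>lborel) = (\<integral>p. norm (?K (p, t)) \<partial>lborel)" if "t \<noteq> 0" for t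
  proof -
    have t2: "t * (t * (inverse t * inverse t)) = 1"
      using that by (simp add: field_simps)
    show "integrable lborel (\<lambda>q. ?G (q, t)) \<longleftrightarrow> integrable lborel (\<lambda>p. ?K (p, t))"
      unfolding lborel_integrable_scaleR_iff[OF G_meas that] GK[OF that]
      using that by (simp del: case_prod_conv)
    show "(\<integral>q. ?G (q, t) \<partial>lborel) = (\<integral>p. ?K (p, t) \<partial>lborel)"
      unfolding lborel_integral_scaleR[OF G_meas that] GK[OF that]
      using t2 by (simp del: case_prod_conv add: power2_eq_square)
    show "(\<integral>q. norm (?G (q, t)) \<partial>lborel) = (\<integral>p. norm (?K (p, t)) \<partial>lborel)"
      unfolding lborel_integral_scaleR[OF measurable_compose[OF G_meas borel_measurable_norm] that] GK[OF that]
      using that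
      by (cases "t > 0") (simp_all del: case_prod_conv add: power2_eq_square abs_mult t2)
  qed
  have swap: "(\<lambda>(t, q). ?G (q, t)) \<in> borel_measurable (lborel \<Otimes>\<^sub>M lborel)"
    using measurable_compose[OF measurable_pair_swap' G] by (simp add: case_prod_unfold)
  have nK_int: "integrable (lborel \<Otimes>\<^sub>M lborel) (\<lambda>(p, t). norm (?K (p, t)))"
    using integrable_norm[OF K_int] by (simp add: case_prod_unfold)
  \<comment> \<open>The coordinates are swapped so that t is the outer variable: the slices known to
    agree with those of \<open>?K\<close> are those at fixed t.\<close>
  have "integrable (lborel \<Otimes>\<^sub>M lborel) (\<lambda>(t, q). ?G (q, t))"
  proof (rule lborel_pair.Fubini_integrable[OF swap])
    have "(\<lambda>t. \<integral>q. norm (case (t, q) of (t, q) \<Rightarrow> ?G (q, t)) \<partial>lborel) \<in> borel_measurable lborel"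
      by (intro lborel.borel_measurable_lebesgue_integral) (use measurable_compose[OF swap borel_measurable_norm] in \<open>simp add: case_prod_unfold\<close>)
    then show "integrable lborel (\<lambda>t. \<integral>q. norm (case (t, q) of (t, q) \<Rightarrow> ?G (q, t)) \<partial>lborel)"
      by (rule integrable_cong_AE_imp[OF lborel_pair.integrable_snd[OF nK_int]])
        (use AEt in eventually_elim, use G_int3 in \<open>simp del: real_norm_def\<close>)
    show "AE t in lborel. integrable lborel (\<lambda>q. case (t, q) of (t, q) \<Rightarrow> ?G (q, t))"
      using AEt lborel_pair.AE_integrable_snd[OF K_int] by eventually_elim (use G_int1 in simp)
  qed
  then have G_int: "integrable (lborel \<Otimes>\<^sub>M lborel) ?G"
    using lborel_pair.integrable_product_swap_iff[of ?G] by simp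
  have "integral\<^sup>L (lborel \<Otimes>\<^sub>M lborel) ?G = (\<integral>t. (\<integral>q. ?G (q, t) \<partial>lborel) \<partial>lborel)"
    using lborel_pair.integral_snd[OF G_int] by simp
  also have "\<dots> = (\<integral>t. (\<integral>p. ?K (p, t) \<partial>lborel) \<partial>lborel)"
    using lborel_pair.integrable_snd[OF G_int] lborel_pair.integrable_snd[OF K_int]
    by (intro integral_cong_AE eventually_mono[OF AEt] G_int2) auto
  also have "\<dots> = - pi * \<eta> 0"
    using lborel_pair.integral_snd[OF K_int] K_val by simp
  finally have G_val: "(\<integral>q. (\<integral>t. ?G (q, t) \<partial>lborel) \<partial>lborel) = - pi * \<eta> 0"
    using lborel_pair.integral_fst'[OF G_int] by simp
  have G_fst: "(\<integral>t. ?G (q, t) \<partial>lborel) = \<eta>' q q / (norm q)\<^sup>2 / 2" if "q \<noteq> 0" for q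
  proof -
    have eq: "(\<lambda>t. ?G (q, t)) = (\<lambda>t. inverse (t ^ 3) * indicator {norm q..} t * \<eta>' q q)"
      by (simp add: indicator_def fun_eq_iff)
    have int: "has_bochner_integral lborel (\<lambda>t. ?G (q, t)) (inverse (2 * (norm q)\<^sup>2) * \<eta>' q q)"
      unfolding eq
      by (intro has_bochner_integral_mult_left has_bochner_integral_inverse_cube) (use that in simp)
    have half: "inverse (2 * (norm q)\<^sup>2) * \<eta>' q q = \<eta>' q q / (norm q)\<^sup>2 / 2"
      using that by (simp add: field_simps)
    show ?thesis
      using has_bochner_integral_integral_eq[OF int] unfolding half .
  qed
  have meas: "(\<lambda>q. \<eta>' q q / (norm q)\<^sup>2) \<in> borel_measurable lborel"
    by measurable
  \<comment> \<open>The factor 2 undoes the half produced by integrating t^(-3); it also turns the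
    value -\<pi> \<open>\<eta> 0\<close> into the claimed one.\<close>
  have "integrable lborel (\<lambda>q. 2 * (\<integral>t. ?G (q, t) \<partial>lborel))"
    using lborel_pair.integrable_fst'[OF G_int] by simp
  moreover have AE_eq: "AE q in lborel. 2 * (\<integral>t. ?G (q, t) \<partial>lborel) = \<eta>' q q / (norm q)\<^sup>2"
    using AE0 by eventually_elim (subst G_fst; simp)
  ultimately have "integrable lborel (\<lambda>q. \<eta>' q q / (norm q)\<^sup>2)"
      and "(\<integral>q. 2 * (\<integral>t. ?G (q, t) \<partial>lborel) \<partial>lborel) = (\<integral>q. \<eta>' q q / (norm q)\<^sup>2 \<partial>lborel)"
    using integrable_cong_AE_imp[OF _ meas AE_eq] integral_cong_AE[OF _ meas AE_eq]
      borel_measurable_integrable by blast+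
  then show ?thesis
    unfolding integral_mult_right_zero G_val has_bochner_integral_iff by simp
qed

end

section \<open>The distributional curvature\<close>

text \<open>On the coordinate fields \<omega> takes the values -y / (2 r^2) and x / (2 r^2), so the
  wedge collects x and y times the partial derivatives into the derivative of \<open>\<eta>\<close>
  along the position vector.\<close>

lemma wedge_connection_form_differential:
  assumes D: "levi_civita_on punctured_plane cone_metric D" and "p \<noteq> 0"
    and \<eta>: "(\<eta> has_derivative \<eta>') (at p)"
  shows "wedge (connection_form D) (differential \<eta>) d_x d_y p = - 1 / 2 * (\<eta>' p / (norm p)\<^sup>2)"
proof -
  have c: "smooth_on punctured_plane d_x" "smooth_on punctured_plane d_y"
    unfolding smooth_on_def d_x_def[abs_def] d_y_def[abs_def] by (auto intro: Ck_on_const)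
  interpret linear \<eta>'
    using \<eta> by (rule has_derivative_linear)
  have "p = fst p *\<^sub>R (1, 0) + snd p *\<^sub>R (0, 1)"
    by (cases p) simp
  then have e: "\<eta>' p = fst p * \<eta>' (1, 0) + snd p * \<eta>' (0, 1)"
    by (metis add scale real_scaleR_def)
  have "wedge (connection_form D) (differential \<eta>) d_x d_y p =
      1 / 2 * (- snd p / (norm p)\<^sup>2) * \<eta>' (0, 1) - 1 / 2 * (fst p / (norm p)\<^sup>2) * \<eta>' (1, 0)"
    unfolding wedge_def differential_def dirderiv_def frechet_derivative_eqI[OF \<eta>]
      connection_form_eq[OF D c(1) assms(2)] connection_form_eq[OF D c(2) assms(2)]
    by (simp add: angular_form_def d_x_def d_y_def)
  also have "\<dots> = - 1 / 2 * (\<eta>' p / (norm p)\<^sup>2)"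
    unfolding e using assms(2) by (simp add: field_simps)
  finally show ?thesis .
qed

lemma plane_test_function:
  assumes "test_function \<eta>"
  shows "plane_test_function \<eta> (\<lambda>p. frechet_derivative \<eta> (at p))"
proof
  have s: "smooth_on UNIV \<eta>" and "compact (closure {p. \<eta> p \<noteq> 0})"
    using assms by (auto simp: test_function_def)
  then show "compact (closure {p. \<eta> p \<noteq> 0})" by blast
  show "(\<eta> has_derivative frechet_derivative \<eta> (at p)) (at p)" for p
    using smooth_on_derivative[OF s] by simp
  show "continuous_on UNIV (\<lambda>p. frechet_derivative \<eta> (at p) v)" for v
    using smooth_on_frechet[OF s] unfolding smooth_on_def by (metis Ck_on.simps(1))
qed

lemma has_bochner_integral_wedge_connection_form:
  assumes D: "levi_civita_on punctured_plane cone_metric D" and \<eta>: "test_function \<eta>"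
  shows "has_bochner_integral lborel
    (\<lambda>p. indicator punctured_plane p *\<^sub>R wedge (connection_form D) (differential \<eta>) d_x d_y p) (pi * \<eta> 0)"
proof -
  interpret plane_test_function \<eta> "\<lambda>p. frechet_derivative \<eta> (at p)"
    using \<eta> by (rule plane_test_function)
  \<comment> \<open>At the origin both sides are 0: the indicator vanishes on the left, and division
    by zero gives 0 on the right.\<close>
  have "indicator punctured_plane p *\<^sub>R wedge (connection_form D) (differential \<eta>) d_x d_y p =
      - 1 / 2 * (frechet_derivative \<eta> (at p) p / (norm p)\<^sup>2)" for p
    using wedge_connection_form_differential[OF D _ deriv, of p] by (cases "p = 0") auto
  moreover have "has_bochner_integral lborel (\<lambda>p. - 1 / 2 * (frechet_derivative \<eta> (at p) p / (norm p)\<^sup>2))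
      (- 1 / 2 * (- 2 * pi * \<eta> 0))"
    by (intro has_bochner_integral_mult_right radial_integral)
  ultimately show ?thesis by simp
qed

theorem proposition5:
  fixes D :: "plane connection"
  assumes "levi_civita_on punctured_plane cone_metric D"
  shows
    "(\<forall>X. smooth_on punctured_plane X \<longrightarrow>
        (\<forall>p\<in>punctured_plane.
           connection_form D X p = 1 / (2 * (norm p)\<^sup>2) * cone_metric p (d_phi p) (X p) \<and>
           connection_form D X p = 1 / 2 * angular_form X p)) \<and>
     (\<forall>X Y. smooth_on punctured_plane X \<longrightarrow> smooth_on punctured_plane Y \<longrightarrow>
        (\<forall>p\<in>punctured_plane.
           curvature_form D X Y p = ext_deriv (connection_form D) X Y p \<and>
           curvature_form D X Y p = 0)) \<and>
     (\<forall>\<eta>. test_function \<eta> \<longrightarrow>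
        form2_integrable_on punctured_plane (wedge (connection_form D) (differential \<eta>)) \<and>
        distr_ext_deriv (connection_form D) \<eta> = pi * \<eta> 0)"
proof (intro conjI allI impI ballI)
  fix X :: "plane vfield" and p assume X: "smooth_on punctured_plane X" and "p \<in> punctured_plane"
  then have p: "p \<noteq> 0" by simp
  show half: "connection_form D X p = 1 / 2 * angular_form X p"
    by (rule connection_form_eq[OF assms X p])
  then show "connection_form D X p = 1 / (2 * (norm p)\<^sup>2) * cone_metric p (d_phi p) (X p)"
    by (simp add: cone_metric_d_phi[OF p] angular_form_eq dot_square_norm)
next
  fix X Y :: "plane vfield" and p assume XY: "smooth_on punctured_plane X" "smooth_on punctured_plane Y" and "p \<in> punctured_plane"
  then have p: "p \<noteq> 0" by simp
  show "curvature_form D X Y p = ext_deriv (connection_form D) X Y p"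
    by (rule curvature_form_eq_ext_deriv[OF assms XY p])
  then show "curvature_form D X Y p = 0"
    using ext_deriv_connection_form[OF assms XY p] by simp
next
  fix \<eta> :: "plane \<Rightarrow> real" assume "test_function \<eta>"
  from has_bochner_integral_wedge_connection_form[OF assms this]
  show "form2_integrable_on punctured_plane (wedge (connection_form D) (differential \<eta>))"
    and "distr_ext_deriv (connection_form D) \<eta> = pi * \<eta> 0"
    by (simp_all add: form2_integrable_on_def distr_ext_deriv_def form2_integral_def
        set_integrable_def set_lebesgue_integral_def has_bochner_integral_iff)
qed

end
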